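(* For every graph $G$, $$2\,\mathrm{anw}(G)\le \mathrm{lsfw}(G)\le 2\,\mathrm{anw}(G)+2 .$$
   Context: All graphs are finite, simple and undirected. Both parameters $\mathrm{anw}$ and $\mathrm{lsfw}$ are assigned value $0$ on the empty graph. Active neighborhood-width. A layout of $G$ is a linear order $\pi=(v_1,\dots,v_n)$ of $V(G)$; put $P_i=\{v_1,\dots,v_i\}$ for $0\le i\le n$. For $u\in P_i$ let $r_i^\pi(u)=N_G(u)\cap (V(G)\setminus P_i)$ (the row of $u$). Let $\mathcal A_i^\pi=\{r_i^\pi(u):u\in P_i\}\setminus\{\emptyset\}$ be the set of distinct nonzero rows. Then $\mathrm{anw}_\pi(G)=\max_i|\mathcal A_i^\pi|$ and $\mathrm{anw}(G)=\min_\pi \mathrm{anw}_\pi(G)$ over all layouts $\pi$. Sequential cable plays. A configuration on $G$ consists of the set of born vertices, a family $\mathcal L$ of pairwise disjoint nonempty sets of born vertices (the live cables), and a set of already placed edges; initially all are empty. With $\ell=|\mathcal L|$ the number of live cables before a move, the moves are: (i) birth$(S)$: introduces a nonempty set $S$ of fresh (not yet born) vertices of $G$ as one live cable; cost $2\ell+1$. (ii) fold$(X,Y)$: replaces two distinct live cables $X,Y$ by $X\cup Y$; cost $2\ell-1$. (iii) block$(X,Y)$: places every edge between two distinct live cables $X,Y$; legal when all these pairs are edges of $G$ and at least one has not already been placed; cost $2\ell$. (iv) clique$(X)$: places every edge inside a live cable $X$; legal when $X$ is a clique of $G$ and at least one internal edge has not already been placed; cost $2\ell$. (v) close$(X)$: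 removes the live cable $X$; legal when every edge of $G$ incident with a vertex of $X$ has already been placed; cost $2\ell-1$. A play (a finite sequence of legal moves from the initial configuration) constructs $G$ if every vertex is born, every edge of $G$ is placed, and every cable is closed. The width of a play is the maximum cost of its moves, and $\mathrm{lsfw}(G)$ is the minimum width of a play constructing $G$. *)

theory Defs
  imports Main
begin

text \<open>A graph is a vertex set \<open>V\<close> together with a set \<open>E\<close> of two-element subsets of \<open>V\<close>.\<close>

definition fin_simple_graph :: "'a set \<Rightarrow> 'a set set \<Rightarrow> bool" where
  "fin_simple_graph V E \<longleftrightarrow> finite V \<and> (\<forall>e\<in>E. e \<subseteq> V \<and> card e = 2)"

definition nbhd :: "'a set \<Rightarrow> 'a set set \<Rightarrow> 'a \<Rightarrow> 'a set" where
  "nbhd V E u = {w \<in> V. {u, w} \<in> E}"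

definition layouts :: "'a set \<Rightarrow> 'a list set" where
  "layouts V = {\<pi>. distinct \<pi> \<and> set \<pi> = V}"

definition row :: "'a set \<Rightarrow> 'a set set \<Rightarrow> 'a list \<Rightarrow> nat \<Rightarrow> 'a \<Rightarrow> 'a set" where
  "row V E \<pi> i u = nbhd V E u \<inter> (V - set (take i \<pi>))"

definition active_rows :: "'a set \<Rightarrow> 'a set set \<Rightarrow> 'a list \<Rightarrow> nat \<Rightarrow> 'a set set" where
  "active_rows V E \<pi> i = row V E \<pi> i ` set (take i \<pi>) - {{}}"

definition anw_layout :: "'a set \<Rightarrow> 'a set set \<Rightarrow> 'a list \<Rightarrow> nat" where
  "anw_layout V E \<pi> = (MAX i\<in>{0..length \<pi>}. card (active_rows V E \<pi> i))"

text \<open>For the empty graph the only layout is \<open>[]\<close>, so the value is \<open>0\<close>.\<close>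

definition anw :: "'a set \<Rightarrow> 'a set set \<Rightarrow> nat" where
  "anw V E = (MIN \<pi>\<in>layouts V. anw_layout V E \<pi>)"

record 'a config =
  born :: "'a set"
  live :: "'a set set"
  placed :: "'a set set"

definition init_config :: "'a config" where
  "init_config = \<lparr>born = {}, live = {}, placed = {}\<rparr>"

datatype 'a move =
    Birth "'a set"
  | Fold "'a set" "'a set"
  | Block "'a set" "'a set"
  | Clique "'a set"
  | Close "'a set"

definition cross_pairs :: "'a set \<Rightarrow> 'a set \<Rightarrow> 'a set set" where
  "cross_pairs X Y = {{x, y} | x y. x \<in> X \<and> y \<in> Y}"

definition inner_pairs :: "'a set \<Rightarrow> 'a set set" where
  "inner_pairs X = {{x, y} | x y. x \<in> X \<and> y \<in> X \<and> x \<noteq> y}"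

fun legal :: "'a set \<Rightarrow> 'a set set \<Rightarrow> 'a config \<Rightarrow> 'a move \<Rightarrow> bool" where
  "legal V E c (Birth S) \<longleftrightarrow> S \<noteq> {} \<and> S \<subseteq> V - born c"
| "legal V E c (Fold X Y) \<longleftrightarrow> X \<in> live c \<and> Y \<in> live c \<and> X \<noteq> Y"
| "legal V E c (Block X Y) \<longleftrightarrow> X \<in> live c \<and> Y \<in> live c \<and> X \<noteq> Y \<and>
     cross_pairs X Y \<subseteq> E \<and> \<not> cross_pairs X Y \<subseteq> placed c"
| "legal V E c (Clique X) \<longleftrightarrow> X \<in> live c \<and>
     inner_pairs X \<subseteq> E \<and> \<not> inner_pairs X \<subseteq> placed c"
| "legal V E c (Close X) \<longleftrightarrow> X \<in> live c \<and> (\<forall>e\<in>E. e \<inter> X \<noteq> {} \<longrightarrow> e \<in> placed c)"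

fun result :: "'a config \<Rightarrow> 'a move \<Rightarrow> 'a config" where
  "result c (Birth S) = c\<lparr>born := born c \<union> S, live := insert S (live c)\<rparr>"
| "result c (Fold X Y) = c\<lparr>live := insert (X \<union> Y) (live c - {X, Y})\<rparr>"
| "result c (Block X Y) = c\<lparr>placed := placed c \<union> cross_pairs X Y\<rparr>"
| "result c (Clique X) = c\<lparr>placed := placed c \<union> inner_pairs X\<rparr>"
| "result c (Close X) = c\<lparr>live := live c - {X}\<rparr>"

text \<open>The argument \<open>l\<close> is the number of live cables before the move. For legal moves the
  truncated subtractions are exact, since \<open>Fold\<close> and \<open>Close\<close> require a live cable.\<close>

fun cost :: "nat \<Rightarrow> 'a move \<Rightarrow> nat" where
  "cost l (Birth S) = 2 * l + 1"
| "cost l (Fold X Y) = 2 * l - 1"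
| "cost l (Block X Y) = 2 * l"
| "cost l (Clique X) = 2 * l"
| "cost l (Close X) = 2 * l - 1"

fun legal_from :: "'a set \<Rightarrow> 'a set set \<Rightarrow> 'a config \<Rightarrow> 'a move list \<Rightarrow> bool" where
  "legal_from V E c [] \<longleftrightarrow> True"
| "legal_from V E c (m # ms) \<longleftrightarrow> legal V E c m \<and> legal_from V E (result c m) ms"

fun width_from :: "'a config \<Rightarrow> 'a move list \<Rightarrow> nat" where
  "width_from c [] = 0"
| "width_from c (m # ms) = max (cost (card (live c)) m) (width_from (result c m) ms)"

definition is_play :: "'a set \<Rightarrow> 'a set set \<Rightarrow> 'a move list \<Rightarrow> bool" where
  "is_play V E ms \<longleftrightarrow> legal_from V E init_config ms"

definition final_config :: "'a move list \<Rightarrow> 'a config" where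
  "final_config ms = foldl result init_config ms"

definition constructs :: "'a set \<Rightarrow> 'a set set \<Rightarrow> 'a move list \<Rightarrow> bool" where
  "constructs V E ms \<longleftrightarrow> is_play V E ms \<and>
     born (final_config ms) = V \<and> placed (final_config ms) = E \<and> live (final_config ms) = {}"

definition play_width :: "'a move list \<Rightarrow> nat" where
  "play_width ms = width_from init_config ms"

text \<open>On the empty graph the only play is the empty one, whose width is \<open>0\<close>.\<close>

definition lsfw :: "'a set \<Rightarrow> 'a set set \<Rightarrow> nat" where
  "lsfw V E = (LEAST w. \<exists>ms. constructs V E ms \<and> play_width ms = w)"

end

theory Submission
  imports Defs
begin

text \<open>Upper bound: following a layout, keep as live cables the classes of processed vertices
  having the same nonempty row. The next vertex is born as a singleton, blocked against the
  cables whose row contains it, and then cables with empty row are closed and cables with equal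
  rows are folded; at most one cable more than the active rows is ever live.

  Lower bound: lay out the vertices in order of birth. Fix a prefix \<open>P\<close> and a configuration in
  which \<open>P\<close> is born and no edge leaving \<open>P\<close> is placed. Two vertices of \<open>P\<close> in one live cable are
  treated alike by all later moves, so they have the same row, and a closed vertex has empty row;
  hence there are at least as many live cables as active rows. Births, folds and closures preserve
  such a configuration, so this count still holds at the next block or clique move, whose cost is
  twice the number of live cables.\<close>

section \<open>Rows relative to a vertex set, and concatenation of move sequences\<close>

definition out :: "'a set \<Rightarrow> 'a set set \<Rightarrow> 'a set \<Rightarrow> 'a \<Rightarrow> 'a set" where
  "out V E P u = {w \<in> V - P. {u, w} \<in> E}"

text \<open>Taking a set in place of a layout with an index lets the same count be applied to the
  vertices born so far in a play, before any layout has been chosen.\<close>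

definition out_rows :: "'a set \<Rightarrow> 'a set set \<Rightarrow> 'a set \<Rightarrow> 'a set set" where
  "out_rows V E P = out V E P ` P - {{}}"

lemma active_rows_eq_out_rows: "active_rows V E \<pi> i = out_rows V E (set (take i \<pi>))"
proof -
  have "row V E \<pi> i = out V E (set (take i \<pi>))"
    by (auto simp: row_def nbhd_def out_def fun_eq_iff)
  then show ?thesis by (simp add: active_rows_def out_rows_def)
qed

lemma anw_layout_le_iff:
  "anw_layout V E \<pi> \<le> k \<longleftrightarrow> (\<forall>i\<le>length \<pi>. card (out_rows V E (set (take i \<pi>))) \<le> k)"
  by (auto simp: anw_layout_def active_rows_eq_out_rows)

lemma finite_layouts: "finite V \<Longrightarrow> finite (layouts V)"
  by (rule finite_subset[OF _ finite_lists_length_eq[of V "card V"]])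
    (auto simp: layouts_def distinct_card)

lemma legal_from_append:
  "legal_from V E c (ms @ ns) \<longleftrightarrow> legal_from V E c ms \<and> legal_from V E (foldl result c ms) ns"
  by (induction ms arbitrary: c) auto

lemma width_from_append:
  "width_from c (ms @ ns) = max (width_from c ms) (width_from (foldl result c ms) ns)"
  by (induction ms arbitrary: c) auto

subsection \<open>From a play to a layout\<close>

text \<open>Invariant of all reachable configurations. The last clause remembers what a closure
  demanded: a born vertex outside every live cable has all its edges placed. Disjointness makes the
  cable of a vertex unique.\<close>

definition wf_config :: "'a set \<Rightarrow> 'a set set \<Rightarrow> 'a config \<Rightarrow> bool" where
  "wf_config V E c \<longleftrightarrow> born c \<subseteq> V \<and> live c \<subseteq> Pow (born c) \<and> pairwise disjnt (live c) \<and>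
     placed c \<subseteq> Pow (born c) \<and>
     (\<forall>u\<in>born c. u \<in> \<Union>(live c) \<or> (\<forall>e\<in>E. u \<in> e \<longrightarrow> e \<in> placed c))"

lemma wf_config_init: "wf_config V E init_config"
  by (simp add: wf_config_def init_config_def)

lemma wf_config_result:
  assumes "wf_config V E c" "legal V E c m"
  shows "wf_config V E (result c m)"
proof -
  have wf: "born c \<subseteq> V" "live c \<subseteq> Pow (born c)" "pairwise disjnt (live c)"
      "placed c \<subseteq> Pow (born c)"
      "\<forall>u\<in>born c. u \<in> \<Union>(live c) \<or> (\<forall>e\<in>E. u \<in> e \<longrightarrow> e \<in> placed c)"
    using assms(1) by (simp_all add: wf_config_def)
  show ?thesis
  proof (cases m)
    case (Birth S)
    then have S: "S \<subseteq> V - born c" using assms by simp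
    have "pairwise disjnt (insert S (live c))"
      using wf(2,3) S unfolding pairwise_insert disjnt_def by blast
    moreover have "born c \<union> S \<subseteq> V" "insert S (live c) \<subseteq> Pow (born c \<union> S)"
        "placed c \<subseteq> Pow (born c \<union> S)"
      using wf S by blast+
    moreover have "\<forall>u\<in>born c \<union> S. u \<in> \<Union>(insert S (live c)) \<or> (\<forall>e\<in>E. u \<in> e \<longrightarrow> e \<in> placed c)"
      using wf(5) by blast
    ultimately show ?thesis using Birth by (simp add: wf_config_def)
  next
    case (Fold X Y)
    then have XY: "X \<in> live c" "Y \<in> live c" using assms by auto
    have "disjnt (X \<union> Y) Z" if "Z \<in> live c - {X, Y}" for Z
    proof -
      have "disjnt X Z" "disjnt Y Z" using wf(3) XY that by (auto simp: pairwise_def)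
      then show ?thesis by (auto simp: disjnt_def)
    qed
    moreover have "pairwise disjnt (live c - {X, Y})" by (rule pairwise_subset[OF wf(3)]) auto
    ultimately have "pairwise disjnt (insert (X \<union> Y) (live c - {X, Y}))"
      unfolding pairwise_insert by (blast intro: disjnt_sym)
    moreover have "insert (X \<union> Y) (live c - {X, Y}) \<subseteq> Pow (born c)" using wf(2) XY by blast
    moreover have "\<Union>(insert (X \<union> Y) (live c - {X, Y})) = \<Union>(live c)" using XY by blast
    ultimately show ?thesis using wf Fold by (simp add: wf_config_def)
  next
    case (Block X Y)
    then have "X \<subseteq> born c" "Y \<subseteq> born c" using assms(2) wf(2) by auto
    then have "cross_pairs X Y \<subseteq> Pow (born c)" by (auto simp: cross_pairs_def)
    with wf Block show ?thesis by (auto simp: wf_config_def)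
  next
    case (Clique X)
    then have "X \<subseteq> born c" using assms(2) wf(2) by auto
    then have "inner_pairs X \<subseteq> Pow (born c)" by (auto simp: inner_pairs_def)
    with wf Clique show ?thesis by (auto simp: wf_config_def)
  next
    case (Close X)
    then have "\<forall>e\<in>E. e \<inter> X \<noteq> {} \<longrightarrow> e \<in> placed c" using assms(2) by simp
    then have "\<forall>u\<in>born c. u \<in> \<Union>(live c - {X}) \<or> (\<forall>e\<in>E. u \<in> e \<longrightarrow> e \<in> placed c)"
      using wf(5) by blast
    moreover have "pairwise disjnt (live c - {X})" by (rule pairwise_subset[OF wf(3)]) auto
    moreover have "live c - {X} \<subseteq> Pow (born c)" using wf(2) by blast
    ultimately show ?thesis using wf Close by (simp add: wf_config_def)
  qed
qed

text \<open>While \<open>{u, w}\<close> is unplaced, the cable holding \<open>u\<close> and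
  \<open>u'\<close> cannot be closed and can only grow by folds, so the two stay together. The block
  or clique that places \<open>{u, w}\<close> treats the whole cable of \<open>u\<close>; it
  therefore also covers \<open>{u', w}\<close>, and its legality puts this pair into
  \<open>E\<close>. For a clique, \<open>w \<noteq> u'\<close> makes it a genuine pair.\<close>

lemma same_cable_twins:
  assumes "wf_config V E c" "legal_from V E c ms" "X \<in> live c" "u \<in> X" "u' \<in> X"
    "{u, w} \<in> E" "{u, w} \<notin> placed c" "{u, w} \<in> placed (foldl result c ms)" "w \<noteq> u'"
  shows "{u', w} \<in> E"
  using assms
proof (induction ms arbitrary: c X)
  case Nil
  then show ?case by simp
next
  case (Cons m ms)
  have wf: "wf_config V E (result c m)" and leg: "legal V E c m"
    using Cons.prems wf_config_result by auto
  have unique: "Y = X" if "Y \<in> live c" "u \<in> Y" for Y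
    using that Cons.prems(1,3,4) unfolding wf_config_def pairwise_def disjnt_def by blast
  show ?case
  proof (cases "{u, w} \<in> placed (result c m)")
    case True
    then show ?thesis
    proof (cases m)
      case (Block Y Z)
      then obtain y z where yz: "{u, w} = {y, z}" "y \<in> Y" "z \<in> Z"
        using True Cons.prems by (auto simp: cross_pairs_def)
      have sub: "cross_pairs Y Z \<subseteq> E" "Y \<in> live c" "Z \<in> live c"
        using leg Block by auto
      have "u = y \<and> w = z \<or> u = z \<and> w = y" using yz by (auto simp: doubleton_eq_iff)
      then have "{u', w} \<in> cross_pairs Y Z"
      proof
        assume "u = y \<and> w = z"
        then have "u' \<in> Y" "w \<in> Z" using unique[of Y] sub yz Cons.prems by auto
        then show ?thesis by (auto simp: cross_pairs_def)
      next
        assume "u = z \<and> w = y"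
        then have "u' \<in> Z" "w \<in> Y" using unique[of Z] sub yz Cons.prems by auto
        then show ?thesis by (auto simp: cross_pairs_def insert_commute)
      qed
      then show ?thesis using sub by auto
    next
      case (Clique Y)
      then have "u \<in> Y" "w \<in> Y"
        using True Cons.prems by (auto simp: inner_pairs_def doubleton_eq_iff)
      then have "{u', w} \<in> inner_pairs Y"
        using unique[of Y] leg Clique Cons.prems by (auto simp: inner_pairs_def)
      then show ?thesis using leg Clique by auto
    qed (use Cons.prems in auto)
  next
    case False
    obtain X' where "X' \<in> live (result c m)" "X \<subseteq> X'"
    proof (cases m)
      case (Fold Y Z)
      then show ?thesis using Cons.prems that by (cases "X = Y \<or> X = Z") auto
    next
      case (Close Y)
      \<comment> \<open>Closing \<open>X\<close> would require the edge \<open>{u, w}\<close>, which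
        meets \<open>X\<close> in \<open>u\<close>, to be placed already.\<close>
      then have "Y \<noteq> X" using leg Cons.prems by auto
      then show ?thesis using Close Cons.prems that by auto
    qed (use Cons.prems that in auto)
    then show ?thesis
      using Cons.IH[OF wf, of X'] Cons.prems False by auto
  qed
qed

text \<open>A vertex with nonempty row has an unplaced edge leaving \<open>P\<close>, so it still
  lies in a live cable. Vertices of \<open>P\<close> in one cable have equal rows by
  \<open>same_cable_twins\<close>, so the live cables map onto a set containing all nonempty
  rows.\<close>

lemma card_out_rows_le_live:
  assumes "finite V" "wf_config V E c" "legal_from V E c ms" "placed (foldl result c ms) = E"
    "P \<subseteq> born c" "placed c \<subseteq> Pow P"
  shows "card (out_rows V E P) \<le> card (live c)"
proof -
  \<comment> \<open>For a cable missing \<open>P\<close> the value is arbitrary. This does no harm,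
    because the map only has to cover the rows.\<close>
  define rep where "rep X = (SOME u. u \<in> X \<inter> P)" for X
  have fin: "finite (live c)"
    using assms by (meson finite_Pow_iff finite_subset wf_config_def)
  have out_mono: "out V E P u \<subseteq> out V E P u'"
    if "X \<in> live c" "u \<in> X \<inter> P" "u' \<in> X \<inter> P" for u u' X
  proof
    fix w assume "w \<in> out V E P u"
    then have w: "w \<in> V" "w \<notin> P" "{u, w} \<in> E" by (auto simp: out_def)
    have "{u', w} \<in> E"
      by (rule same_cable_twins[OF assms(2,3) that(1), of u u' w]) (use w that assms in auto)
    then show "w \<in> out V E P u'" using w by (auto simp: out_def)
  qed
  have "out_rows V E P \<subseteq> (\<lambda>X. out V E P (rep X)) ` live c"
  proof
    fix R assume "R \<in> out_rows V E P"
    then obtain u where u: "u \<in> P" "R = out V E P u" "R \<noteq> {}" by (auto simp: out_rows_def)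
    then obtain w where w: "w \<notin> P" "{u, w} \<in> E" by (auto simp: out_def)
    then have "{u, w} \<notin> placed c" using assms by auto
    then obtain X where X: "X \<in> live c" "u \<in> X" using assms u w by (force simp: wf_config_def)
    then have "rep X \<in> X \<inter> P" unfolding rep_def using u by (metis IntI someI)
    then have "R = out V E P (rep X)"
      using out_mono[OF X(1), of u "rep X"] out_mono[OF X(1), of "rep X" u] X u by blast
    then show "R \<in> (\<lambda>X. out V E P (rep X)) ` live c" using X by auto
  qed
  then show ?thesis by (rule surj_card_le[OF fin])
qed

text \<open>Folds and closures cost only \<open>2 * l - 1\<close>, so the bound is not read off at
  the current move but at the first one that changes \<open>placed\<close>; the hypotheses on
  \<open>P\<close> survive until then. If no such move comes, no cable is live at the end and the
  row count is zero.\<close>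

lemma width_from_ge_out_rows:
  assumes "finite V" "wf_config V E c" "legal_from V E c ms"
    "placed (foldl result c ms) = E" "live (foldl result c ms) = {}"
    "P \<subseteq> born c" "placed c \<subseteq> Pow P"
  shows "2 * card (out_rows V E P) \<le> width_from c ms"
  using assms
proof (induction ms arbitrary: c)
  case Nil
  then show ?case using card_out_rows_le_live[of V E c "[]" P] by simp
next
  case (Cons m ms)
  have wf: "wf_config V E (result c m)"
    using Cons.prems wf_config_result by auto
  have le: "card (out_rows V E P) \<le> card (live c)"
    by (rule card_out_rows_le_live[where ms = "m # ms"]) (use Cons.prems in auto)
  show ?case
  proof (cases "placed (result c m) = placed c")
    case True
    moreover have "born c \<subseteq> born (result c m)" by (cases m) auto
    ultimately have "2 * card (out_rows V E P) \<le> width_from (result c m) ms"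
      using Cons.prems by (intro Cons.IH[OF _ wf]) auto
    then show ?thesis by simp
  next
    case False
    then have "cost (card (live c)) m = 2 * card (live c)" by (cases m) auto
    then show ?thesis using le by simp
  qed
qed

text \<open>Vertices born together may be listed in any order: \<open>width_from_ge_out_rows\<close>
  allows \<open>P\<close> to lie strictly between the born sets before and after a birth, so it also
  handles prefixes that cut through one birth.\<close>

lemma birth_order:
  assumes "finite V" "wf_config V E c" "legal_from V E c ms"
    "born (foldl result c ms) = V" "placed (foldl result c ms) = E" "live (foldl result c ms) = {}"
  shows "\<exists>\<sigma>. distinct \<sigma> \<and> set \<sigma> = V - born c \<and>
    (\<forall>i. 2 * card (out_rows V E (born c \<union> set (take i \<sigma>))) \<le> width_from c ms)"
  using assms
proof (induction ms arbitrary: c)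
  case Nil
  then have "2 * card (out_rows V E (born c)) \<le> width_from c []"
    by (intro width_from_ge_out_rows) (auto simp: wf_config_def)
  then show ?case using Nil by auto
next
  case (Cons m ms)
  have wf: "wf_config V E (result c m)"
    using Cons.prems wf_config_result by auto
  then obtain \<sigma> where \<sigma>: "distinct \<sigma>" "set \<sigma> = V - born (result c m)"
      "\<And>i. 2 * card (out_rows V E (born (result c m) \<union> set (take i \<sigma>))) \<le> width_from (result c m) ms"
    using Cons.IH[OF Cons.prems(1) wf] Cons.prems by auto
  \<comment> \<open>\<open>\<tau>\<close> enumerates the vertices introduced by \<open>m\<close>; it
    is empty unless \<open>m\<close> is a birth.\<close>
  have "\<exists>\<tau>. distinct \<tau> \<and> set \<tau> = born (result c m) - born c \<and> born c \<subseteq> born (result c m)"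
    using wf Cons.prems(1) finite_distinct_list[of "born (result c m) - born c"]
    by (cases m) (auto simp: wf_config_def finite_subset)
  then obtain \<tau> where \<tau>: "distinct \<tau>" "set \<tau> = born (result c m) - born c"
      "born c \<subseteq> born (result c m)" by blast
  have "2 * card (out_rows V E (born c \<union> set (take i (\<tau> @ \<sigma>)))) \<le> width_from c (m # ms)" for i
  proof (cases "length \<tau> \<le> i")
    case True
    then have "born c \<union> set (take i (\<tau> @ \<sigma>)) = born (result c m) \<union> set (take (i - length \<tau>) \<sigma>)"
      using \<tau> by auto
    then show ?thesis using \<sigma>(3)[of "i - length \<tau>"] by simp
  next
    case False
    then have "\<tau> \<noteq> []" by auto
    \<comment> \<open>A move that introduces vertices is a birth and places nothing, so every placed
      edge still lies within the old born set.\<close>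
    have placed: "placed (result c m) \<subseteq> Pow (born c)" if "\<tau> \<noteq> []"
    proof -
      have "born (result c m) \<noteq> born c" using that \<tau>(2) by auto
      then show ?thesis using Cons.prems(2) by (cases m) (auto simp: wf_config_def)
    qed
    have "2 * card (out_rows V E (born c \<union> set (take i \<tau>))) \<le> width_from (result c m) ms"
    proof (rule width_from_ge_out_rows[OF Cons.prems(1) wf])
      show "born c \<union> set (take i \<tau>) \<subseteq> born (result c m)"
        using \<tau> by (auto dest: in_set_takeD)
      show "placed (result c m) \<subseteq> Pow (born c \<union> set (take i \<tau>))"
        using placed[OF \<open>\<tau> \<noteq> []\<close>] by auto
    qed (use Cons.prems in auto)
    then show ?thesis using False by simp
  qed
  moreover have "distinct (\<tau> @ \<sigma>)" "set (\<tau> @ \<sigma>) = V - born c"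
    using \<tau> \<sigma> wf by (auto simp: wf_config_def)
  ultimately show ?case by blast
qed

lemma anw_le_play_width:
  assumes "finite V" "constructs V E ms"
  shows "2 * anw V E \<le> play_width ms"
proof -
  have "\<exists>\<sigma>. distinct \<sigma> \<and> set \<sigma> = V - born init_config \<and>
    (\<forall>i. 2 * card (out_rows V E (born init_config \<union> set (take i \<sigma>))) \<le> width_from init_config ms)"
    by (rule birth_order[OF assms(1) wf_config_init])
      (use assms(2) in \<open>auto simp: constructs_def is_play_def final_config_def\<close>)
  then obtain \<sigma> where \<sigma>: "distinct \<sigma>" "set \<sigma> = V"
      "\<And>i. 2 * card (out_rows V E (set (take i \<sigma>))) \<le> play_width ms"
    by (auto simp: init_config_def play_width_def)
  have "anw_layout V E \<sigma> \<le> play_width ms div 2"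
    unfolding anw_layout_le_iff using \<sigma>(3) by (simp add: less_eq_div_iff_mult_less_eq mult.commute)
  moreover have "anw V E \<le> anw_layout V E \<sigma>"
    unfolding anw_def using \<sigma> finite_layouts[OF assms(1)] by (intro Min_le) (auto simp: layouts_def)
  ultimately show ?thesis by linarith
qed

subsection \<open>From a layout to a play\<close>

text \<open>Reachability within a width budget. Hiding the move list makes it transitive, since the
  width of a concatenation is a maximum.\<close>

definition attains :: "'a set \<Rightarrow> 'a set set \<Rightarrow> nat \<Rightarrow> 'a config \<Rightarrow> 'a config \<Rightarrow> bool" where
  "attains V E w c d \<longleftrightarrow>
     (\<exists>ms. legal_from V E c ms \<and> width_from c ms \<le> w \<and> foldl result c ms = d)"

lemma attains_refl: "attains V E w c c"
  unfolding attains_def by (rule exI[of _ "[]"]) simp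

lemma attains_trans: "attains V E w c d \<Longrightarrow> attains V E w d e \<Longrightarrow> attains V E w c e"
  unfolding attains_def
  by (metis foldl_append legal_from_append max.bounded_iff width_from_append)

lemma attains_move:
  "legal V E c m \<Longrightarrow> cost (card (live c)) m \<le> w \<Longrightarrow> attains V E w c (result c m)"
  unfolding attains_def by (rule exI[of _ "[m]"]) simp

text \<open>Weaker than one cable per nonempty row: distinct cables may share a row, and cables with
  empty row may still be live. \<open>merge_cables\<close> removes both. Only vertices whose edges
  all lie inside \<open>P\<close> may have left the live cables.\<close>

definition tracks :: "'a set \<Rightarrow> 'a set set \<Rightarrow> 'a set \<Rightarrow> 'a config \<Rightarrow> bool" where
  "tracks V E P c \<longleftrightarrow> born c = P \<and> placed c = {e \<in> E. e \<subseteq> P} \<and> finite (live c) \<and>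
     (\<forall>X\<in>live c. X \<noteq> {} \<and> X \<subseteq> P \<and> (\<forall>x\<in>X. \<forall>y\<in>X. out V E P x = out V E P y)) \<and>
     (\<forall>u\<in>P. out V E P u \<noteq> {} \<longrightarrow> u \<in> \<Union>(live c))"

lemma edge_doubleton:
  assumes "fin_simple_graph V E" "e \<in> E" "x \<in> e"
  obtains y where "e = {x, y}" "x \<noteq> y" "y \<in> V"
proof -
  have "card e = 2" "e \<subseteq> V" using assms by (auto simp: fin_simple_graph_def)
  then show ?thesis using assms(3) that by (auto simp: card_2_iff)
qed

text \<open>A cable with empty row can be closed, as all its edges lie inside \<open>P\<close> and
  are placed; two cables with a common row can be folded. Each such move costs at most
  \<open>2 * k + 1\<close> and lowers the number of live cables. When neither applies, cables inject
  into the nonempty rows.\<close>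

lemma merge_cables:
  assumes "fin_simple_graph V E" "tracks V E P c" "card (live c) \<le> Suc k"
  shows "\<exists>d. attains V E (2 * k + 2) c d \<and> tracks V E P d \<and> card (live d) \<le> card (out_rows V E P)"
  using assms
proof (induction "card (live c)" arbitrary: c rule: less_induct)
  case less
  have placed: "placed c = {e \<in> E. e \<subseteq> P}" and fin: "finite (live c)"
    and born: "born c = P"
    using less.prems(2) unfolding tracks_def by blast+
  have cover: "u \<in> \<Union>(live c)" if "u \<in> P" "out V E P u \<noteq> {}" for u
    using less.prems(2) that unfolding tracks_def by blast
  have sub: "X \<noteq> {} \<and> X \<subseteq> P" if "X \<in> live c" for X
    using less.prems(2) that unfolding tracks_def by blast
  have same: "out V E P x = out V E P y" if "X \<in> live c" "x \<in> X" "y \<in> X" for X x y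
    using less.prems(2) that unfolding tracks_def by blast
  have step: ?case
    if st: "legal V E c m" "cost (card (live c)) m \<le> 2 * k + 2" "tracks V E P (result c m)"
      "card (live (result c m)) < card (live c)" for m
  proof -
    obtain d where "attains V E (2 * k + 2) (result c m) d" "tracks V E P d"
        "card (live d) \<le> card (out_rows V E P)"
      using less.hyps[OF st(4) less.prems(1) st(3)] st(4) less.prems(3) by auto
    then show ?thesis using attains_trans[OF attains_move[OF st(1,2)]] by blast
  qed
  show ?case
  proof (cases "\<exists>X\<in>live c. \<exists>x\<in>X. out V E P x = {}")
    case True
    then obtain X where X: "X \<in> live c" "\<And>x. x \<in> X \<Longrightarrow> out V E P x = {}"
      using same by metis
    show ?thesis
    proof (rule step[of "Close X"])
      have "e \<subseteq> P" if ex: "e \<in> E" "x \<in> e" "x \<in> X" for e x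
      proof -
        obtain y where "e = {x, y}" "y \<in> V" using edge_doubleton[OF less.prems(1) ex(1,2)] .
        moreover have "x \<in> P" using sub X(1) ex(3) by blast
        ultimately show ?thesis using X(2)[OF ex(3)] ex by (auto simp: out_def)
      qed
      then show "legal V E c (Close X)" using X(1) placed by auto
      show "tracks V E P (result c (Close X))"
        using less.prems(2) X(2) unfolding tracks_def by simp blast
      show "card (live (result c (Close X))) < card (live c)"
        using X(1) fin by (simp add: card_Diff1_less del: card_Diff_insert)
    qed (use less.prems in auto)
  next
    case nonempty: False
    show ?thesis
    proof (cases "\<exists>X\<in>live c. \<exists>Y\<in>live c. X \<noteq> Y \<and> (\<exists>x\<in>X. \<exists>y\<in>Y. out V E P x = out V E P y)")
      case True
      then obtain X Y x y where XY: "X \<in> live c" "Y \<in> live c" "X \<noteq> Y" "x \<in> X" "y \<in> Y"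
        "out V E P x = out V E P y" by blast
      show ?thesis
      proof (rule step[of "Fold X Y"])
        show "legal V E c (Fold X Y)" using XY by simp
        have z: "out V E P z = out V E P x" if "z \<in> X \<union> Y" for z
          using same XY that by (metis Un_iff)
        have XY_same: "X \<union> Y \<noteq> {} \<and> X \<union> Y \<subseteq> P \<and>
            (\<forall>z\<in>X \<union> Y. \<forall>z'\<in>X \<union> Y. out V E P z = out V E P z')"
          using sub[OF XY(1)] sub[OF XY(2)] z by (metis Un_empty Un_least)
        let ?d = "result c (Fold X Y)"
        have d: "born ?d = P" "placed ?d = {e \<in> E. e \<subseteq> P}" "finite (live ?d)"
            "live ?d = insert (X \<union> Y) (live c - {X, Y})"
          using born placed fin by simp_all
        have "Z \<noteq> {} \<and> Z \<subseteq> P \<and> (\<forall>z\<in>Z. \<forall>z'\<in>Z. out V E P z = out V E P z')"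
          if "Z \<in> live ?d" for Z
        proof (cases "Z = X \<union> Y")
          case True
          show ?thesis unfolding True by (rule XY_same)
        next
          case False
          then have "Z \<in> live c" using that by simp
          then show ?thesis using sub same by blast
        qed
        moreover have "u \<in> \<Union>(live ?d)" if "u \<in> P" "out V E P u \<noteq> {}" for u
          unfolding d(4) using cover[OF that] XY by blast
        ultimately show "tracks V E P ?d"
          unfolding tracks_def using d(1-3) by (intro conjI ballI impI) blast+
        \<comment> \<open>Two cables go and at most one comes in, so the count drops even if
          \<open>X \<union> Y\<close> is already among the remaining sets.\<close>
        have "card (live c - {X, Y}) = card (live c) - 2" "2 \<le> card (live c)"
          using XY(1-3) fin card_mono[of "live c" "{X, Y}"] by (auto simp: card_Diff_subset)
        then show "card (live (result c (Fold X Y))) < card (live c)"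
          using card_insert_if[of "live c - {X, Y}" "X \<union> Y"] fin by (auto split: if_splits)
      qed (use less.prems in auto)
    next
      case False
      define rep where "rep X = (SOME x. x \<in> X)" for X :: "'a set"
      have rep: "rep X \<in> X" if "X \<in> live c" for X
        unfolding rep_def using sub[OF that] by (simp add: some_in_eq)
      have "card (live c) \<le> card (out_rows V E P)"
      proof (rule card_inj_on_le)
        show "inj_on (\<lambda>X. out V E P (rep X)) (live c)"
        proof (rule inj_onI)
          fix X Y assume "X \<in> live c" "Y \<in> live c" "out V E P (rep X) = out V E P (rep Y)"
          then show "X = Y" using False rep[of X] rep[of Y] by blast
        qed
        show "(\<lambda>X. out V E P (rep X)) ` live c \<subseteq> out_rows V E P"
        proof
          fix R assume "R \<in> (\<lambda>X. out V E P (rep X)) ` live c"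
          then obtain X where X: "X \<in> live c" "R = out V E P (rep X)" by blast
          then have "rep X \<in> P" "R \<noteq> {}" using nonempty rep[OF X(1)] sub[OF X(1)] by blast+
          then show "R \<in> out_rows V E P" using X(2) by (simp add: out_rows_def)
        qed
        have "out_rows V E P \<subseteq> Pow V" by (auto simp: out_rows_def out_def)
        then show "finite (out_rows V E P)"
          using less.prems(1) by (meson fin_simple_graph_def finite_Pow_iff finite_subset)
      qed
      then show ?thesis using less.prems attains_refl by blast
    qed
  qed
qed

text \<open>With up to \<open>k + 1\<close> live cables a block costs up to
  \<open>2 * k + 2\<close>; this sets the budget of the whole construction. A block adding no new
  edge is illegal, but then the configuration is already the desired one and the move is
  skipped.\<close>

lemma block_cables:
  assumes "finite F" "F \<subseteq> live c - {Y}" "Y \<in> live c" "card (live c) \<le> Suc k"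
    "\<And>X. X \<in> F \<Longrightarrow> cross_pairs X Y \<subseteq> E"
  shows "attains V E (2 * k + 2) c (c\<lparr>placed := placed c \<union> (\<Union>X\<in>F. cross_pairs X Y)\<rparr>)"
  using assms
proof (induction F)
  case empty
  then show ?case by (simp add: attains_refl)
next
  case (insert X F)
  let ?d = "c\<lparr>placed := placed c \<union> (\<Union>X\<in>F. cross_pairs X Y)\<rparr>"
  let ?e = "c\<lparr>placed := placed c \<union> (\<Union>X\<in>insert X F. cross_pairs X Y)\<rparr>"
  have d: "attains V E (2 * k + 2) c ?d" using insert by auto
  have e: "?e = result ?d (Block X Y)" by (simp add: Un_ac)
  show ?case
  proof (cases "cross_pairs X Y \<subseteq> placed ?d")
    case True
    then have "placed c \<union> (\<Union>X\<in>insert X F. cross_pairs X Y) = placed c \<union> (\<Union>X\<in>F. cross_pairs X Y)"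
      by auto
    then show ?thesis using d by (simp only:)
  next
    case False
    have "attains V E (2 * k + 2) ?d ?e" unfolding e
      by (rule attains_move) (use False insert.prems in auto)
    then show ?thesis using attains_trans[OF d] by blast
  qed
qed

lemma out_insert: "out V E (insert v P) u = out V E P u - {v}"
  by (auto simp: out_def)

text \<open>Since \<open>v\<close> is born alone, all new edges inside \<open>insert v P\<close> run
  from \<open>v\<close> to older vertices. Rows are constant on cables, so \<open>v\<close> is
  adjacent to all or none of each cable, and blocks with the cables in \<open>F\<close> place
  exactly these edges. By \<open>out_insert\<close>, equal rows remain equal.\<close>

lemma add_vertex:
  assumes G: "fin_simple_graph V E" and tr: "tracks V E P c" and "card (live c) \<le> k"
    and v: "v \<in> V" "v \<notin> P"
  shows "\<exists>d. attains V E (2 * k + 2) c d \<and> tracks V E (insert v P) d \<and>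
    card (live d) \<le> card (out_rows V E (insert v P))"
proof -
  note t = tr[unfolded tracks_def]
  define F where "F = {X \<in> live c. \<exists>x\<in>X. v \<in> out V E P x}"
  define c1 where "c1 = result c (Birth {v})"
  define c2 where "c2 = c1\<lparr>placed := placed c1 \<union> (\<Union>X\<in>F. cross_pairs X {v})\<rparr>"
  have v_out: "v \<in> out V E P x" if "X \<in> F" "x \<in> X" for X x
    using that t unfolding F_def by blast
  have card1: "card (live c1) \<le> Suc k"
    using assms(3) t by (simp add: c1_def card_insert_if)
  have "attains V E (2 * k + 2) c c1" unfolding c1_def
    by (rule attains_move) (use assms(3) v t in auto)
  moreover have "attains V E (2 * k + 2) c1 c2" unfolding c2_def
  proof (rule block_cables)
    show "finite F" "F \<subseteq> live c1 - {{v}}" "{v} \<in> live c1"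
      using t v by (auto simp: F_def c1_def)
    show "cross_pairs X {v} \<subseteq> E" if "X \<in> F" for X
      using v_out[OF that] by (auto simp: cross_pairs_def out_def)
  qed (rule card1)
  moreover have "tracks V E (insert v P) c2"
  proof -
    have "e \<in> placed c2" if e: "e \<in> E" "e \<subseteq> insert v P" for e
    proof (cases "v \<in> e")
      case True
      then obtain y where y: "e = {v, y}" "v \<noteq> y" using edge_doubleton[OF G e(1)] by metis
      \<comment> \<open>The row of \<open>y\<close> contains \<open>v\<close> and is thus nonempty,
        so \<open>y\<close> still lies in a live cable.\<close>
      then have "y \<in> P" "v \<in> out V E P y" using e v by (auto simp: out_def insert_commute)
      then obtain X where "X \<in> F" "y \<in> X" using t unfolding F_def by blast
      then have "e \<in> (\<Union>X\<in>F. cross_pairs X {v})"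
        using y by (auto simp: cross_pairs_def insert_commute)
      then show ?thesis by (simp add: c2_def)
    next
      case False
      then show ?thesis using e t by (auto simp: c1_def c2_def)
    qed
    moreover have "e \<in> E \<and> e \<subseteq> insert v P" if e: "e \<in> placed c2" for e
    proof -
      consider "e \<in> placed c" | X x where "X \<in> F" "x \<in> X" "e = {x, v}"
        using e by (auto simp: c2_def c1_def cross_pairs_def)
      then show ?thesis
      proof cases
        case 1
        then show ?thesis using t by auto
      next
        case 2
        then show ?thesis using v_out[OF 2(1,2)] t by (auto simp: out_def F_def)
      qed
    qed
    ultimately have "placed c2 = {e \<in> E. e \<subseteq> insert v P}" by blast
    moreover have "X \<noteq> {} \<and> X \<subseteq> insert v P \<and>
        (\<forall>x\<in>X. \<forall>y\<in>X. out V E (insert v P) x = out V E (insert v P) y)" if "X \<in> live c2" for X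
    proof (cases "X = {v}")
      case False
      then have X: "X \<in> live c" using that by (auto simp: c1_def c2_def)
      then have "out V E P x = out V E P y" if "x \<in> X" "y \<in> X" for x y using t that by blast
      then show ?thesis using X t unfolding out_insert by blast
    qed simp
    moreover have "u \<in> \<Union>(live c2)" if "u \<in> insert v P" "out V E (insert v P) u \<noteq> {}" for u
      using that t unfolding out_insert by (auto simp: c1_def c2_def)
    moreover have "born c = P" "finite (live c)" using t by blast+
    then have "born c2 = insert v P" "finite (live c2)" by (simp_all add: c1_def c2_def)
    ultimately show ?thesis unfolding tracks_def by blast
  qed
  moreover have "card (live c2) \<le> Suc k" using card1 by (simp add: c2_def)
  ultimately show ?thesis using merge_cables[OF G] attains_trans by metis
qed

lemma layout_play:
  assumes G: "fin_simple_graph V E" and \<pi>: "\<pi> \<in> layouts V"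
  shows "\<exists>ms. constructs V E ms \<and> play_width ms \<le> 2 * anw_layout V E \<pi> + 2"
proof -
  define k where "k = anw_layout V E \<pi>"
  have k: "card (out_rows V E (set (take i \<pi>))) \<le> k" if "i \<le> length \<pi>" for i
    using anw_layout_le_iff[of V E \<pi> k] that by (simp add: k_def)
  have V: "set \<pi> = V" "distinct \<pi>" using \<pi> by (auto simp: layouts_def)
  \<comment> \<open>The empty set is the only candidate for an edge inside the empty prefix, so the
    initial configuration has placed all it should.\<close>
  have no_empty: "{} \<notin> E" using G by (auto simp: fin_simple_graph_def)
  have "\<exists>d. attains V E (2 * k + 2) init_config d \<and> tracks V E (set (take i \<pi>)) d \<and>
      card (live d) \<le> card (out_rows V E (set (take i \<pi>)))" if "i \<le> length \<pi>" for i
    using that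
  proof (induction i)
    case 0
    have "tracks V E {} init_config" using no_empty by (auto simp: tracks_def init_config_def)
    then show ?case using attains_refl[of V E "2 * k + 2" init_config]
      by (auto simp: init_config_def intro!: exI[of _ init_config])
  next
    case (Suc i)
    then obtain d where d: "attains V E (2 * k + 2) init_config d"
        "tracks V E (set (take i \<pi>)) d" "card (live d) \<le> k"
      using k[of i] by fastforce
    have "\<pi> ! i \<in> V" using V(1) Suc.prems by auto
    moreover have "\<pi> ! i \<notin> set (take i \<pi>)"
      using V(2) Suc.prems by (auto simp: in_set_conv_nth nth_eq_iff_index_eq)
    ultimately obtain d' where "attains V E (2 * k + 2) d d'"
        "tracks V E (insert (\<pi> ! i) (set (take i \<pi>))) d'"
        "card (live d') \<le> card (out_rows V E (insert (\<pi> ! i) (set (take i \<pi>))))"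
      using add_vertex[OF G d(2,3)] by blast
    moreover have "set (take (Suc i) \<pi>) = insert (\<pi> ! i) (set (take i \<pi>))"
      using Suc.prems by (simp add: take_Suc_conv_app_nth)
    ultimately show ?case using attains_trans[OF d(1)] by metis
  qed
  from this[of "length \<pi>"] obtain d where d: "attains V E (2 * k + 2) init_config d"
      "tracks V E V d" "card (live d) \<le> card (out_rows V E V)"
    using V by auto
  \<comment> \<open>No vertex lies outside \<open>V\<close>, so the row count is zero and the finite
    set of live cables is empty: the play has closed everything.\<close>
  have "out_rows V E V = {}" by (auto simp: out_rows_def out_def)
  then have "live d = {}" "born d = V" "placed d = E"
    using d(2,3) G by (auto simp: tracks_def fin_simple_graph_def)
  then show ?thesis
    using d(1) unfolding k_def[symmetric]
    by (auto simp: attains_def constructs_def is_play_def final_config_def play_width_def)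
qed

theorem theorem3p6:
  fixes V :: "'a set" and E :: "'a set set"
  assumes "fin_simple_graph V E"
  shows "2 * anw V E \<le> lsfw V E \<and> lsfw V E \<le> 2 * anw V E + 2"
proof -
  have fin: "finite V" using assms by (simp add: fin_simple_graph_def)
  have "layouts V \<noteq> {}" using finite_distinct_list[OF fin] by (auto simp: layouts_def)
  then have "anw V E \<in> anw_layout V E ` layouts V"
    unfolding anw_def by (intro Min_in) (auto simp: finite_layouts[OF fin])
  then obtain ms where ms: "constructs V E ms" "play_width ms \<le> 2 * anw V E + 2"
    using layout_play[OF assms] by (metis (no_types, lifting) imageE)
  have "lsfw V E \<le> play_width ms"
    unfolding lsfw_def by (rule Least_le) (use ms(1) in blast)
  \<comment> \<open>The play built for the upper bound also shows that the minimum is attained, so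
    the lower bound can be applied to an optimal play.\<close>
  moreover have "\<exists>ms. constructs V E ms \<and> play_width ms = lsfw V E"
    unfolding lsfw_def by (rule LeastI_ex) (use ms(1) in blast)
  ultimately show ?thesis using anw_le_play_width[OF fin] ms(2) by fastforce
qed

end
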